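(* Let $\mathcal{C}\subseteq\mathbb{F}_2^n$ be a binary linear code of length $n$ and dimension $k$ ($1\le k\le n$), with parity check matrix $H$, minimum distance $d$ and error-correcting capability $t=\lfloor (d-1)/2\rfloor$. Let $<_T$ be a total degree compatible admissible ordering on $[X]$, and let $G_T$ be the reduced Gröbner basis of the ideal $I(\mathcal{C})\subset K[X]$ with respect to $<_T$. Let $w\in[X]$. (1) If $\mathrm{weight}(\psi(\mathrm{Can}(w,G_T)))\le t$, then $\psi(\mathrm{Can}(w,G_T))$ is the error vector corresponding to $\psi(w)$. (2) If $\mathrm{weight}(\psi(\mathrm{Can}(w,G_T)))>t$, then $\psi(w)$ contains more than $t$ errors, i.e. $\psi(w)\notin B(\mathcal{C},t)$.
   Context: Vectors of $\mathbb{F}_2^n$ are row vectors; $\mathrm{weight}$ denotes Hamming weight and $d(\cdot,\cdot)$ Hamming distance. The parity check matrix $H$ is an $n\times(n-k)$ matrix over $\mathbb{F}_2$ such that, for $c\in\mathbb{F}_2^n$, $cH=0$ if and only if $c\in\mathcal{C}$. The minimum distance $d$ is the minimum Hamming distance between distinct codewords. Put $B(\mathcal{C},t)=\{y\in\mathbb{F}_2^n \mid \exists\, c\in\mathcal{C},\ d(c,y)\le t\}$. For $y\in B(\mathcal{C},t)$ the equation $eH=yH$ has a unique solution $e\in\mathbb{F}_2^n$ with $\mathrm{weight}(e)\le t$; this $e$ is called the error vector corresponding to $y$. Saying that $y$ contains more than $t$ errors means $y\notin B(\mathcal{C},t)$. In particular, the assertion that a vector is the error vector corresponding to $y$ includes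 the assertion that $y\in B(\mathcal{C},t)$. $K$ is a field, $X=\{x_1,\dots,x_n\}$ is a set of variables, $[X]$ is the free commutative monoid on $X$ (the monomials), and $K[X]$ is the polynomial ring. The monoid morphism $\psi:[X]\to\mathbb{F}_2^n$ is $\psi(\prod_{i=1}^n x_i^{\beta_i})=(\beta_1 \bmod 2,\dots,\beta_n\bmod 2)$, and $\xi(u):=\psi(u)H\in\mathbb{F}_2^{n-k}$ for $u\in[X]$. The ideal associated with $\mathcal{C}$ is $$I(\mathcal{C}):=\langle\{w-u \mid w,u\in[X],\ \xi(w)=\xi(u)\}\rangle\subset K[X].$$ An admissible ordering on $[X]$ is a total well-ordering compatible with multiplication (a monomial order). It is total degree compatible if $u<_T v$ whenever the total degree of $u$ is strictly smaller than that of $v$ (e.g. degree reverse lexicographic). For $f\in K[X]$, $\mathrm{Can}(f,G_T)$ denotes the canonical form (normal form) of $f$ modulo $I(\mathcal{C})$ with respect to $<_T$: the unique polynomial in the $K$-span of the monomials that are not leading monomials of elements of $I(\mathcal{C})$ such that $f-\mathrm{Can}(f,G_T)\in I(\mathcal{C})$. Since Gröbner bases of $I(\mathcal{C})$ consist of differences of monomials, $\mathrm{Can}(w,G_T)$ is a monomial (an element of $[X]$) whenever $w\in[X]$, so $\psi(\mathrm{Can}(w,G_T))$ is defined. *)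

theory Defs
  imports
    "HOL-Analysis.Cartesian_Space"
    "HOL-Library.Z2"
    "HOL-Library.Poly_Mapping"
begin

section \<open>Binary codes\<close>

text \<open>
  The space of row vectors of length \<open>n\<close> over the two-element field is \<open>bit ^ 'n\<close> with
  \<open>n = CARD('n)\<close>.
\<close>

definition hamming_weight :: "bit ^ 'n::finite \<Rightarrow> nat" where
  "hamming_weight y = card {i. y $ i \<noteq> 0}"

definition hamming_dist :: "bit ^ 'n::finite \<Rightarrow> bit ^ 'n \<Rightarrow> nat" where
  "hamming_dist x y = card {i. x $ i \<noteq> y $ i}"

text \<open>Only meaningful if the code has at least two elements.\<close>

definition min_distance :: "(bit ^ 'n::finite) set \<Rightarrow> nat" where
  "min_distance C = Min {hamming_dist c c' | c c'. c \<in> C \<and> c' \<in> C \<and> c \<noteq> c'}"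

text \<open>
  An \<open>n \<times> m\<close> matrix is given by the list of its \<open>m\<close> columns, and a vector of length \<open>m\<close> by the
  list of its entries. Lists are used here because the number \<open>m = n - k\<close> of columns may be zero,
  whereas the index types of \<open>_ ^ _\<close> are never empty.
\<close>

definition vec_mult_cols :: "bit ^ 'n::finite \<Rightarrow> (bit ^ 'n) list \<Rightarrow> bit list" where
  "vec_mult_cols y H = map (\<lambda>h. \<Sum>i\<in>UNIV. y $ i * h $ i) H"

definition parity_check_matrix :: "(bit ^ 'n::finite) set \<Rightarrow> (bit ^ 'n) list \<Rightarrow> bool" where
  "parity_check_matrix C H \<longleftrightarrow>
     length H = CARD('n) - vec.dim C \<and>
     (\<forall>c. vec_mult_cols c H = replicate (length H) 0 \<longleftrightarrow> c \<in> C)"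

definition code_balls :: "(bit ^ 'n::finite) set \<Rightarrow> nat \<Rightarrow> (bit ^ 'n) set" where
  "code_balls C t = {y. \<exists>c\<in>C. hamming_dist c y \<le> t}"

text \<open>\<open>e\<close> is \<^emph>\<open>the\<close> error vector of \<open>y\<close>, so the uniqueness of \<open>e\<close> is part of the notion.\<close>

definition is_error_vector ::
    "(bit ^ 'n::finite) set \<Rightarrow> (bit ^ 'n) list \<Rightarrow> nat \<Rightarrow> bit ^ 'n \<Rightarrow> bit ^ 'n \<Rightarrow> bool" where
  "is_error_vector C H t y e \<longleftrightarrow>
     y \<in> code_balls C t \<and>
     (vec_mult_cols e H = vec_mult_cols y H \<and> hamming_weight e \<le> t) \<and>
     (\<forall>e'. vec_mult_cols e' H = vec_mult_cols y H \<and> hamming_weight e' \<le> t \<longrightarrow> e' = e)"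


section \<open>Monomials and polynomials\<close>

text \<open>
  A monomial is its exponent vector, so the monoid of monomials is written additively.
  Multiplication of polynomials is the convolution product of \<^theory>\<open>HOL-Library.Poly_Mapping\<close>.
\<close>

type_synonym 'n monomial = "'n \<Rightarrow>\<^sub>0 nat"

type_synonym ('n, 'k) mpoly = "'n monomial \<Rightarrow>\<^sub>0 'k"

definition monom_poly :: "'n monomial \<Rightarrow> ('n, 'k::field) mpoly" where
  "monom_poly u = Poly_Mapping.single u 1"

definition const_mult :: "'k::field \<Rightarrow> ('n, 'k) mpoly \<Rightarrow> ('n, 'k) mpoly" where
  "const_mult a p = Poly_Mapping.single 0 a * p"

definition ideal_gen :: "('n, 'k::field) mpoly set \<Rightarrow> ('n, 'k) mpoly set" where
  "ideal_gen B = module.span (*) B"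

definition total_degree :: "'n::finite monomial \<Rightarrow> nat" where
  "total_degree u = (\<Sum>i\<in>UNIV. Poly_Mapping.lookup u i)"

definition monomial_dvd :: "'n monomial \<Rightarrow> 'n monomial \<Rightarrow> bool" where
  "monomial_dvd u v \<longleftrightarrow> (\<exists>s. v = u + s)"

text \<open>Orderings are represented by the reflexive relation, i.e. \<open>(u, v) \<in> r\<close> means \<open>u \<le> v\<close>.\<close>

definition admissible_ordering :: "'n monomial rel \<Rightarrow> bool" where
  "admissible_ordering r \<longleftrightarrow>
     well_order_on UNIV r \<and> (\<forall>u v s. (u, v) \<in> r \<longrightarrow> (u + s, v + s) \<in> r)"

definition degree_compatible :: "'n::finite monomial rel \<Rightarrow> bool" where
  "degree_compatible r \<longleftrightarrow>
     (\<forall>u v. total_degree u < total_degree v \<longrightarrow> (u, v) \<in> r \<and> u \<noteq> v)"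

text \<open>Only meaningful for nonzero polynomials.\<close>

definition leading_monomial :: "'n monomial rel \<Rightarrow> ('n, 'k::field) mpoly \<Rightarrow> 'n monomial" where
  "leading_monomial r p =
     (THE m. m \<in> Poly_Mapping.keys p \<and> (\<forall>m'\<in>Poly_Mapping.keys p. (m', m) \<in> r))"

definition groebner_basis ::
    "'n monomial rel \<Rightarrow> ('n, 'k::field) mpoly set \<Rightarrow> ('n, 'k) mpoly set \<Rightarrow> bool" where
  "groebner_basis r I G \<longleftrightarrow>
     finite G \<and> ideal_gen G = I \<and>
     (\<forall>p\<in>I. p \<noteq> 0 \<longrightarrow>
        (\<exists>g\<in>G. g \<noteq> 0 \<and> monomial_dvd (leading_monomial r g) (leading_monomial r p)))"

definition reduced_groebner_basis ::
    "'n monomial rel \<Rightarrow> ('n, 'k::field) mpoly set \<Rightarrow> ('n, 'k) mpoly set \<Rightarrow> bool" where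
  "reduced_groebner_basis r I G \<longleftrightarrow>
     groebner_basis r I G \<and> 0 \<notin> G \<and>
     (\<forall>g\<in>G. Poly_Mapping.lookup g (leading_monomial r g) = 1 \<and>
        (\<forall>h\<in>G - {g}. \<forall>m\<in>Poly_Mapping.keys g. \<not> monomial_dvd (leading_monomial r h) m))"

definition standard_monomials ::
    "'n monomial rel \<Rightarrow> ('n, 'k::field) mpoly set \<Rightarrow> 'n monomial set" where
  "standard_monomials r I = {m. \<not> (\<exists>p\<in>I. p \<noteq> 0 \<and> leading_monomial r p = m)}"

definition canonical_form ::
    "'n monomial rel \<Rightarrow> ('n, 'k::field) mpoly set \<Rightarrow> ('n, 'k) mpoly \<Rightarrow> ('n, 'k) mpoly" where
  "canonical_form r I f =
     (THE g. g \<in> module.span const_mult (monom_poly ` standard_monomials r I) \<and> f - g \<in> I)"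

text \<open>
  The canonical form of a monomial with respect to a Groebner basis \<open>G\<close> of an ideal,
  as an element of the monoid of monomials. It is only meaningful if the canonical form is a
  monomial.
\<close>

definition Can :: "'n monomial rel \<Rightarrow> ('n, 'k::field) mpoly set \<Rightarrow> 'n monomial \<Rightarrow> 'n monomial" where
  "Can r G w = (THE u. canonical_form r (ideal_gen G) (monom_poly w) = monom_poly u)"


section \<open>The ideal associated with a code\<close>

definition psi :: "'n::finite monomial \<Rightarrow> bit ^ 'n" where
  "psi u = (\<chi> i. of_nat (Poly_Mapping.lookup u i))"

definition xi :: "(bit ^ 'n::finite) list \<Rightarrow> 'n monomial \<Rightarrow> bit list" where
  "xi H u = vec_mult_cols (psi u) H"

definition code_ideal :: "(bit ^ 'n::finite) list \<Rightarrow> ('n, 'k::field) mpoly set" where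
  "code_ideal H = ideal_gen {monom_poly w - monom_poly u | w u. xi H w = xi H u}"

end

theory Submission
  imports Defs
begin

text \<open>
  Call two monomials equivalent if \<open>xi\<close> maps them to the same syndrome. The code ideal \<open>I\<close> is
  generated by the differences of equivalent monomials, and the canonical form of a monomial \<open>w\<close>
  turns out to be the least monomial equivalent to \<open>w\<close> (lemma \<open>Can_fibre_minimum\<close>). The point is
  that this least monomial \<open>u\<close> is not a leading monomial of \<open>I\<close>: in every element of \<open>I\<close> the
  coefficients over each equivalence class add up to zero (lemma \<open>weighted_sum_code_ideal\<close>), so a
  polynomial of \<open>I\<close> in which \<open>u\<close> occurs also contains another member of the class of \<open>u\<close>, which
  is larger.

  Since the ordering refines the total degree, \<open>u\<close> has least degree among the monomials equivalent
  to \<open>w\<close>. Every vector \<open>e\<close> is the image of the squarefree monomial on its support, whose degree is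
  the weight of \<open>e\<close>, and no monomial over \<open>e\<close> has smaller degree. Hence \<open>psi u\<close> has least weight
  in the coset \<open>psi w + C\<close>: it is a coset leader. If its weight is at most \<open>t\<close>, then it
  is the error vector, because two vectors of weight at most \<open>t\<close> in one coset differ by a codeword
  of weight at most \<open>2t < d\<close>, which is zero. If its weight exceeds \<open>t\<close>, then the coset has no vector
  of weight at most \<open>t\<close>, so that no codeword is within distance \<open>t\<close> of \<open>psi w\<close>.
\<close>

section \<open>Words with equal syndrome\<close>

lemma vec_mult_cols_eq_iff:
  fixes x y :: "bit ^ 'n::finite"
  shows
  "vec_mult_cols x H = vec_mult_cols y H \<longleftrightarrow>
     vec_mult_cols (x - y) H = replicate (length H) 0"
proof -
  have diff: "(\<Sum>i\<in>UNIV. (x - y) $ i * h $ i) =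
      (\<Sum>i\<in>UNIV. x $ i * h $ i) - (\<Sum>i\<in>UNIV. y $ i * h $ i)"
    for h :: "bit ^ 'n"
    by (simp only: vector_minus_component left_diff_distrib sum_subtractf)
  show ?thesis
    by (simp only: vec_mult_cols_def map_replicate_const[symmetric] map_eq_conv diff right_minus_eq)
qed

lemma same_syndrome_iff:
  assumes "parity_check_matrix C H"
  shows "vec_mult_cols x H = vec_mult_cols y H \<longleftrightarrow> x - y \<in> C"
  using assms unfolding vec_mult_cols_eq_iff[of x] parity_check_matrix_def by blast

lemma psi_add: "psi (u + v) = psi u + psi v"
  by (simp add: psi_def vec_eq_iff lookup_add)

text \<open>
  Having equal syndromes is a congruence on the monoid of monomials; this makes the fibres of \<open>xi\<close>
  compatible with multiplication in the polynomial ring.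
\<close>

lemma xi_add_cong:
  assumes "xi H u = xi H v"
  shows "xi H (s + u) = xi H (s + v)"
proof -
  have "(psi s + psi u) - (psi s + psi v) = psi u - psi v"
    by simp
  then show ?thesis
    using assms by (simp only: xi_def psi_add vec_mult_cols_eq_iff)
qed


section \<open>Canonical forms modulo the code ideal\<close>

interpretation mpoly_ring: module "(*) :: ('n, 'k::field) mpoly \<Rightarrow> _"
  by unfold_locales (simp_all add: algebra_simps)

interpretation mpoly_vs: module "const_mult :: 'k::field \<Rightarrow> ('n, 'k) mpoly \<Rightarrow> _"
  by unfold_locales
    (simp_all add: const_mult_def distrib_left distrib_right single_add mult_single
      flip: mult.assoc)

text \<open>
  This is the linear form on polynomials that takes the value \<open>f m\<close> on each monomial \<open>m\<close>. Forms
  for which \<open>f\<close> is constant on the fibres of \<open>xi\<close> serve as test functions: they vanish on the code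
  ideal, which gives a necessary condition for membership.
\<close>

definition weighted_sum :: "('n monomial \<Rightarrow> 'k) \<Rightarrow> ('n, 'k::field) mpoly \<Rightarrow> 'k" where
  "weighted_sum f p = (\<Sum>m\<in>Poly_Mapping.keys p. Poly_Mapping.lookup p m * f m)"

lemma weighted_sum_superset:
  assumes "finite A" "Poly_Mapping.keys p \<subseteq> A"
  shows "weighted_sum f p = (\<Sum>m\<in>A. Poly_Mapping.lookup p m * f m)"
  unfolding weighted_sum_def
  by (rule sum.mono_neutral_left) (use assms in \<open>auto simp: in_keys_iff\<close>)

lemma weighted_sum_zero [simp]: "weighted_sum f 0 = 0"
  by (simp add: weighted_sum_def)

lemma weighted_sum_single [simp]: "weighted_sum f (Poly_Mapping.single m c) = c * f m"
  by (subst weighted_sum_superset[of "{m}"]) auto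

lemma weighted_sum_add [simp]: "weighted_sum f (p + q) = weighted_sum f p + weighted_sum f q"
proof -
  let ?A = "Poly_Mapping.keys p \<union> Poly_Mapping.keys q"
  have "weighted_sum f (p + q) = (\<Sum>m\<in>?A. Poly_Mapping.lookup (p + q) m * f m)"
    by (rule weighted_sum_superset) (simp_all add: Poly_Mapping.keys_add)
  also have "\<dots> = (\<Sum>m\<in>?A. Poly_Mapping.lookup p m * f m) + (\<Sum>m\<in>?A. Poly_Mapping.lookup q m * f m)"
    by (simp add: lookup_add distrib_right sum.distrib)
  also have "\<dots> = weighted_sum f p + weighted_sum f q"
    by (simp add: weighted_sum_superset[of ?A])
  finally show ?thesis .
qed

lemma weighted_sum_diff [simp]: "weighted_sum f (p - q) = weighted_sum f p - weighted_sum f q"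
  using weighted_sum_add[of f "p - q" q] by simp

lemma mpoly_induct [case_names zero single add]:
  fixes p :: "('n, 'k::field) mpoly"
  assumes "P 0" "\<And>m c. P (Poly_Mapping.single m c)" "\<And>p q. P p \<Longrightarrow> P q \<Longrightarrow> P (p + q)"
  shows "P p"
proof (induction p rule: update_induct)
  case (update p m c)
  have "Poly_Mapping.update m c p = Poly_Mapping.single m c + p"
    using update.hyps by (intro poly_mapping_eqI)
      (auto simp: lookup_update lookup_add lookup_single when_def in_keys_iff)
  then show ?case
    using assms(2,3) update.IH by simp
qed (rule assms(1))

lemma weighted_sum_mult:
  "weighted_sum f (q * p) = weighted_sum (\<lambda>s. weighted_sum (\<lambda>m. f (s + m)) p) q"
proof (induction q rule: mpoly_induct)
  case (single s c)
  then show ?case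
    by (induction p rule: mpoly_induct)
      (simp_all add: mult_single distrib_left mult.assoc)
qed (simp_all add: distrib_right)

text \<open>
  A generator \<open>u - v\<close> is killed because \<open>f u = f v\<close>. A multiple \<open>q * (u - v)\<close> is killed because
  multiplication by a monomial \<open>s\<close> only replaces \<open>f\<close> by its translate \<open>\<lambda>m. f (s + m)\<close>, which is
  again constant on the fibres of \<open>xi\<close>.
\<close>

lemma weighted_sum_code_ideal:
  assumes "p \<in> code_ideal H"
    and "\<And>u v. xi H u = xi H v \<Longrightarrow> f u = f v"
  shows "weighted_sum f p = 0"
  using assms unfolding code_ideal_def ideal_gen_def
proof (induction p arbitrary: f rule: mpoly_ring.span_induct_alt)
  case base
  show ?case by simp
next
  case (step q g p)
  from step.hyps obtain u v where g: "g = monom_poly u - monom_poly v" "xi H u = xi H v"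
    by auto
  have "weighted_sum (\<lambda>m. f (s + m)) g = 0" for s
    using step.prems[OF xi_add_cong[OF g(2)]] by (simp add: g(1) monom_poly_def)
  then have "weighted_sum f (q * g) = 0"
    by (simp add: weighted_sum_mult weighted_sum_def[of "\<lambda>_. 0"])
  then show ?case
    using step.IH[OF step.prems] by simp
qed

text \<open>
  The description by \<open>THE\<close> is met because a nonempty finite set has a greatest element in a total order.
\<close>

lemma leading_monomial_greatest:
  assumes "admissible_ordering r" "p \<noteq> 0"
  shows "leading_monomial r p \<in> Poly_Mapping.keys p"
    and "\<And>m. m \<in> Poly_Mapping.keys p \<Longrightarrow> (m, leading_monomial r p) \<in> r"
proof -
  have lin: "refl r" "trans r" "antisym r" "total r"
    using assms(1) by (auto simp: admissible_ordering_def well_order_on_def linear_order_on_def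
        partial_order_on_def preorder_on_def)
  have "\<exists>m\<in>A. \<forall>m'\<in>A. (m', m) \<in> r" if "finite A" "A \<noteq> {}" for A
    using that
  proof (induction A rule: finite_ne_induct)
    case (singleton a)
    then show ?case using lin(1) by (auto simp: refl_on_def)
  next
    case (insert a A)
    then obtain m where m: "m \<in> A" "\<forall>m'\<in>A. (m', m) \<in> r" by blast
    have "(a, m) \<in> r \<or> (m, a) \<in> r"
      using lin(1,4) by (cases "a = m") (auto simp: refl_on_def total_on_def)
    then show ?case
    proof
      assume "(a, m) \<in> r"
      then show ?case using m by blast
    next
      assume "(m, a) \<in> r"
      then have "(m', a) \<in> r" if "m' \<in> A" for m'
        using m(2) that lin(2) by (blast dest: transD)
      moreover have "(a, a) \<in> r"
        using lin(1) by (simp add: refl_on_def)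
      ultimately show ?case by blast
    qed
  qed
  from this[of "Poly_Mapping.keys p"] obtain m
    where m: "m \<in> Poly_Mapping.keys p" "\<forall>m'\<in>Poly_Mapping.keys p. (m', m) \<in> r"
    using assms(2) by auto
  have "leading_monomial r p = m"
    unfolding leading_monomial_def
    using m lin(3) by (intro the_equality) (auto dest: antisymD)
  with m show "leading_monomial r p \<in> Poly_Mapping.keys p"
    and "\<And>m. m \<in> Poly_Mapping.keys p \<Longrightarrow> (m, leading_monomial r p) \<in> r"
    by auto
qed

text \<open>
  If \<open>u\<close> were the leading monomial of \<open>p\<close> in the ideal, then \<open>u\<close> would be the only monomial of \<open>p\<close>
  in its fibre, the others being too large. The sum of the coefficients of \<open>p\<close> over this fibre would
  then be the leading coefficient, although it has to vanish.
\<close>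

lemma fibre_minimal_standard:
  fixes H :: "(bit ^ 'n::finite) list"
  assumes r: "admissible_ordering r"
    and minimal: "\<And>v. xi H v = xi H u \<Longrightarrow> (u, v) \<in> r"
  shows "u \<in> standard_monomials r (code_ideal H :: ('n, 'k::field) mpoly set)"
proof -
  have False
    if p: "p \<in> code_ideal H" "p \<noteq> 0" "leading_monomial r p = u" for p :: "('n, 'k) mpoly"
  proof -
    define f :: "'n monomial \<Rightarrow> 'k" where "f m = (if xi H m = xi H u then 1 else 0)" for m
    have u: "u \<in> Poly_Mapping.keys p"
      and lead: "\<And>m. m \<in> Poly_Mapping.keys p \<Longrightarrow> (m, u) \<in> r"
      using leading_monomial_greatest[OF r p(2)] p(3) by auto
    have "m = u" if "m \<in> Poly_Mapping.keys p" "xi H m = xi H u" for m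
      using lead[OF that(1)] minimal[OF that(2)] r
      by (auto simp: admissible_ordering_def well_order_on_def linear_order_on_def
          partial_order_on_def dest: antisymD)
    then have "weighted_sum f p = (\<Sum>m\<in>{u}. Poly_Mapping.lookup p m * f m)"
      unfolding weighted_sum_def
      by (intro sum.mono_neutral_right) (use u in \<open>auto simp: f_def\<close>)
    then have "weighted_sum f p = Poly_Mapping.lookup p u"
      by (simp add: f_def)
    moreover have "weighted_sum f p = 0"
      by (rule weighted_sum_code_ideal[OF p(1)]) (simp add: f_def)
    ultimately show False
      using u by (simp add: in_keys_iff)
  qed
  then show ?thesis
    by (auto simp: standard_monomials_def)
qed

lemma keys_span_monom_poly:
  assumes "g \<in> module.span const_mult (monom_poly ` S)"
  shows "Poly_Mapping.keys g \<subseteq> S"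
  using assms
proof (induction rule: mpoly_vs.span_induct_alt)
  case base
  show ?case by simp
next
  case (step a x g)
  then obtain s where "s \<in> S" "x = monom_poly s" by auto
  then have "Poly_Mapping.keys (const_mult a x) \<subseteq> S"
    by (simp add: const_mult_def monom_poly_def mult_single)
  with step.IH show ?case
    using Poly_Mapping.keys_add[of "const_mult a x" g] by blast
qed

text \<open>This is what makes canonical forms unique.\<close>

lemma standard_polynomial_in_ideal_zero:
  assumes r: "admissible_ordering r"
    and "p \<in> I" "Poly_Mapping.keys p \<subseteq> standard_monomials r I"
  shows "p = 0"
proof (rule ccontr)
  assume "p \<noteq> 0"
  then have "leading_monomial r p \<in> standard_monomials r I"
    using leading_monomial_greatest(1)[OF r] assms(3) by blast
  then show False
    using \<open>p \<in> I\<close> \<open>p \<noteq> 0\<close> unfolding standard_monomials_def by blast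
qed

lemma canonical_form_code_ideal:
  fixes H :: "(bit ^ 'n::finite) list"
  assumes r: "admissible_ordering r"
    and same: "xi H u = xi H w"
    and minimal: "\<And>v. xi H v = xi H u \<Longrightarrow> (u, v) \<in> r"
  shows "canonical_form r (code_ideal H :: ('n, 'k::field) mpoly set) (monom_poly w) = monom_poly u"
proof -
  let ?I = "code_ideal H :: ('n, 'k) mpoly set"
  let ?S = "module.span const_mult (monom_poly ` standard_monomials r ?I) :: ('n, 'k) mpoly set"
  have uS: "monom_poly u \<in> ?S"
    using fibre_minimal_standard[OF r minimal] by (intro mpoly_vs.span_base imageI) blast
  have wu: "monom_poly w - monom_poly u \<in> ?I"
    unfolding code_ideal_def ideal_gen_def
    using same[symmetric] by (intro mpoly_ring.span_base) blast
  have "g = monom_poly u" if g: "g \<in> ?S" "monom_poly w - g \<in> ?I" for g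
  proof -
    have "(monom_poly w - monom_poly u) - (monom_poly w - g) \<in> ?I"
      using wu g(2) unfolding code_ideal_def ideal_gen_def by (rule mpoly_ring.span_diff)
    then have "g - monom_poly u \<in> ?I"
      by simp
    moreover have "Poly_Mapping.keys (g - monom_poly u) \<subseteq> standard_monomials r ?I"
      using g(1) uS by (intro keys_span_monom_poly mpoly_vs.span_diff)
    ultimately have "g - monom_poly u = 0"
      by (rule standard_polynomial_in_ideal_zero[OF r])
    then show ?thesis by simp
  qed
  then show ?thesis
    unfolding canonical_form_def using uS wu by (intro the_equality) blast+
qed

lemma monom_poly_eq_iff: "(monom_poly u :: ('n, 'k::field) mpoly) = monom_poly v \<longleftrightarrow> u = v"
  unfolding monom_poly_def by (metis keys_single one_neq_zero singleton_inject)

text \<open>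
  The well-ordering provides a least element of the fibre of \<open>w\<close>, and this element is the canonical
  form of every monomial in the fibre.
\<close>

lemma Can_fibre_minimum:
  fixes H :: "(bit ^ 'n::finite) list"
    and G :: "('n, 'k::field) mpoly set"
  assumes r: "admissible_ordering r"
    and G: "ideal_gen G = code_ideal H"
  shows "xi H (Can r G w) = xi H w"
    and "\<And>v. xi H v = xi H w \<Longrightarrow> (Can r G w, v) \<in> r"
proof -
  have r': "wf (r - Id)" "total r" "refl r"
    using r by (auto simp: admissible_ordering_def well_order_on_def linear_order_on_def
        partial_order_on_def preorder_on_def)
  obtain u where u: "xi H u = xi H w" "\<And>v. (v, u) \<in> r - Id \<Longrightarrow> xi H v \<noteq> xi H w"
    using wfE_min[OF r'(1), of w "{v. xi H v = xi H w}"] by auto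
  have minimal: "(u, v) \<in> r" if "xi H v = xi H w" for v
    using u(2)[of v] that r'(2,3) by (cases "v = u") (auto simp: refl_on_def total_on_def)
  have "canonical_form r (ideal_gen G) (monom_poly w) = (monom_poly u :: ('n, 'k) mpoly)"
    unfolding G using u(1) minimal by (intro canonical_form_code_ideal[OF r]) auto
  then have Can: "Can r G w = u"
    by (simp add: Can_def monom_poly_eq_iff)
  show "xi H (Can r G w) = xi H w"
    unfolding Can by (rule u(1))
  show "\<And>v. xi H v = xi H w \<Longrightarrow> (Can r G w, v) \<in> r"
    unfolding Can by (rule minimal)
qed


section \<open>Weights and degrees\<close>

lemma hamming_dist_diff: "hamming_dist (y - e) y = hamming_weight e"
  by (simp only: hamming_dist_def hamming_weight_def vector_minus_component diff_eq_eq
      add_cancel_right_right)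

lemma hamming_dist_eq_0_iff: "hamming_dist x y = 0 \<longleftrightarrow> x = y"
  unfolding hamming_dist_def vec_eq_iff by (subst card_0_eq[OF finite]) blast

lemma hamming_weight_diff_le: "hamming_weight (x - y) \<le> hamming_weight x + hamming_weight y"
proof -
  have "card {i. (x - y) $ i \<noteq> 0} \<le> card ({i. x $ i \<noteq> 0} \<union> {i. y $ i \<noteq> 0})"
    by (intro card_mono) auto
  also have "\<dots> \<le> card {i. x $ i \<noteq> 0} + card {i. y $ i \<noteq> 0}"
    by (rule card_Un_le)
  finally show ?thesis
    by (simp add: hamming_weight_def)
qed

text \<open>
  A nonzero coordinate of \<open>psi u\<close> comes from an odd exponent, which contributes at least \<open>1\<close> to the
  degree.
\<close>

lemma hamming_weight_psi_le: "hamming_weight (psi u) \<le> total_degree u"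
proof -
  have "hamming_weight (psi u) = (\<Sum>i | psi u $ i \<noteq> 0. 1)"
    by (simp add: hamming_weight_def)
  also have "\<dots> \<le> (\<Sum>i | psi u $ i \<noteq> 0. Poly_Mapping.lookup u i)"
  proof (rule sum_mono)
    fix i assume "i \<in> {i. psi u $ i \<noteq> 0}"
    then have "Poly_Mapping.lookup u i \<noteq> 0"
      by (auto simp: psi_def intro: ccontr)
    then show "1 \<le> Poly_Mapping.lookup u i" by simp
  qed
  also have "\<dots> \<le> total_degree u"
    unfolding total_degree_def by (rule sum_mono2) auto
  finally show ?thesis .
qed

text \<open>
  The squarefree monomial on the support of \<open>e\<close> shows that the bound in \<open>hamming_weight_psi_le\<close> is
  attained over every vector.
\<close>

lemma squarefree_psi_preimage:
  fixes e :: "bit ^ 'n::finite"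
  obtains u where "psi u = e" "total_degree u = hamming_weight e"
proof
  define u where "u = Abs_poly_mapping (\<lambda>i. if e $ i = 0 then 0 else 1 :: nat)"
  have lookup: "Poly_Mapping.lookup u i = (if e $ i = 0 then 0 else 1)" for i
    by (simp add: u_def)
  show "psi u = e"
    by (auto simp: psi_def vec_eq_iff lookup)
  show "total_degree u = hamming_weight e"
  proof -
    have "total_degree u = (\<Sum>i | e $ i \<noteq> 0. 1)"
      unfolding total_degree_def by (rule sum.mono_neutral_cong_right) (auto simp: lookup)
    then show ?thesis
      by (simp add: hamming_weight_def)
  qed
qed

text \<open>
  A nonzero codeword \<open>c\<close> has distance at least \<open>d\<close> from \<open>0\<close>. The truncated subtraction in
  \<open>(d - 1) div 2\<close> does no harm: the pair of \<open>c\<close> and \<open>0\<close> makes the set of distances nonempty,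
  so \<open>d\<close> is a distance of two distinct words and thus positive.
\<close>

lemma low_weight_codeword_zero:
  fixes C :: "(bit ^ 'n::finite) set"
  assumes "0 \<in> C" "c \<in> C" "hamming_weight c \<le> 2 * ((min_distance C - 1) div 2)"
  shows "c = 0"
proof (rule ccontr)
  assume "c \<noteq> 0"
  let ?D = "{hamming_dist c c' | c c'. c \<in> C \<and> c' \<in> C \<and> c \<noteq> c'}"
  have fin: "finite ?D"
    by (rule finite_subset[of _ "{..CARD('n)}"]) (auto simp: hamming_dist_def intro: card_mono)
  have mem: "hamming_weight c \<in> ?D"
  proof -
    have "hamming_weight c = hamming_dist c 0"
      by (simp only: hamming_weight_def hamming_dist_def zero_index)
    then show ?thesis
      using assms(1,2) \<open>c \<noteq> 0\<close> by blast
  qed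
  have "min_distance C \<le> hamming_weight c"
    unfolding min_distance_def by (rule Min_le[OF fin mem])
  moreover have "min_distance C \<in> ?D"
    unfolding min_distance_def using fin mem by (intro Min_in) auto
  then have "min_distance C \<noteq> 0"
    using hamming_dist_eq_0_iff by fastforce
  ultimately show False
    using assms(3) by linarith
qed


section \<open>Decoding by canonical forms\<close>

theorem theorem2:
  fixes C :: "(bit ^ 'n::finite) set"
    and H :: "(bit ^ 'n) list"
    and k d t :: nat
    and r :: "'n monomial rel"
    and G :: "('n, 'k::field) mpoly set"
    and w :: "'n monomial"
  assumes linear: "vec.subspace C"
    and dim: "vec.dim C = k" "1 \<le> k" "k \<le> CARD('n)"
    and H: "parity_check_matrix C H"
    and d: "d = min_distance C"
    and t: "t = (d - 1) div 2"
    and r: "admissible_ordering r" "degree_compatible r"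
    and G: "reduced_groebner_basis r (code_ideal H) G"
  shows "(hamming_weight (psi (Can r G w)) \<le> t \<longrightarrow>
            is_error_vector C H t (psi w) (psi (Can r G w))) \<and>
         (hamming_weight (psi (Can r G w)) > t \<longrightarrow> psi w \<notin> code_balls C t)"
proof -
  define u where "u = Can r G w"
  have gen: "ideal_gen G = code_ideal H"
    using G by (simp add: reduced_groebner_basis_def groebner_basis_def)
  have same: "vec_mult_cols (psi u) H = vec_mult_cols (psi w) H"
    using Can_fibre_minimum(1)[OF r(1) gen, of w] by (simp add: xi_def u_def)
  have minimal: "(u, v) \<in> r" if "xi H v = xi H w" for v
    using Can_fibre_minimum(2)[OF r(1) gen that] by (simp add: u_def)

  have "is_error_vector C H t (psi w) (psi u)" if weight: "hamming_weight (psi u) \<le> t"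
    unfolding is_error_vector_def
  proof (intro conjI allI impI)
    have "psi w - psi u \<in> C"
      using same same_syndrome_iff[OF H] by metis
    then show "psi w \<in> code_balls C t"
      unfolding code_balls_def using weight
      by (intro CollectI bexI[of _ "psi w - psi u"]) (simp only: hamming_dist_diff)
  next
    fix e assume e: "vec_mult_cols e H = vec_mult_cols (psi w) H \<and> hamming_weight e \<le> t"
    have "e - psi u \<in> C"
      using e same by (simp flip: same_syndrome_iff[OF H])
    moreover have "hamming_weight (e - psi u) \<le> 2 * t"
      using hamming_weight_diff_le[of e "psi u"] e weight by simp
    ultimately have "e - psi u = 0"
      using low_weight_codeword_zero[of C] vec.subspace_0[OF linear] t d by blast
    then show "e = psi u" by simp
  qed (use same weight in auto)

  moreover have "hamming_weight (psi u) \<le> t" if y: "psi w \<in> code_balls C t"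
  proof -
    obtain c where c: "c \<in> C" "hamming_dist c (psi w) \<le> t"
      using y by (auto simp: code_balls_def)
    define e where "e = psi w - c"
    have weight: "hamming_weight e \<le> t"
      using c(2) hamming_dist_diff[of "psi w" e] by (simp add: e_def)
    obtain v where v: "psi v = e" "total_degree v = hamming_weight e"
      by (rule squarefree_psi_preimage)
    have "vec_mult_cols (psi w) H = vec_mult_cols e H"
      using c(1) by (simp add: same_syndrome_iff[OF H] e_def)
    then have uv: "(u, v) \<in> r"
      using v(1) by (intro minimal) (simp add: xi_def)
    have "total_degree u \<le> total_degree v"
    proof (rule ccontr)
      assume "\<not> total_degree u \<le> total_degree v"
      then have "(v, u) \<in> r" "v \<noteq> u"
        using r(2) by (auto simp: degree_compatible_def)
      with uv r(1) show False
        by (auto simp: admissible_ordering_def well_order_on_def linear_order_on_def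
            partial_order_on_def dest: antisymD)
    qed
    then show ?thesis
      using hamming_weight_psi_le[of u] v(2) weight by simp
  qed

  ultimately show ?thesis
    by (auto simp: u_def)
qed

end
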